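(* Let $T$ be the random recursive tree in which each new vertex is connected to the last vertex with probability $p$ or to the second-last vertex with probability $q=1-p$. Then $$\mathbb{P}(\text{the random recursive tree } T \text{ has exactly one topological end})=1.$$
   Context: Random recursive tree. Start with the graph $T_1=(V_1,E_1)$, where $V_1=\{v_0,v_1\}$ and $E_1=\{\langle v_0,v_1\rangle\}$. At step $n\ge 1$, given $T_n=(V_n,E_n)$ with $V_n=\{v_0,\dots,v_n\}$, put $V_{n+1}=V_n\cup\{v_{n+1}\}$ and $E_{n+1}=E_n\cup\{\langle v_{n+1},w_n\rangle\}$, where the $w_n$ are independent random variables with $\mathbb{P}(w_n=v_n)=p$ and $\mathbb{P}(w_n=v_{n-1})=q=1-p$. The random recursive tree is $T=\bigcup_{n\ge1}T_n$. Topological ends. A simple path is a path with no repeated vertices. For a tree, the number of topological ends is defined as the number of infinite simple paths from any fixed vertex (since $T$ is connected, this number is the same for every vertex).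
   Formalization: The formal statement assumes 0 < p ≤ 1; the case p = 0 is excluded because there each new vertex joins the second-last one, so the tree is a bi-infinite path with two topological ends and the claim fails. *)

theory Defs
  imports "HOL-Probability.Probability"
begin

text \<open>Undirected graphs are given by a vertex set \<open>V\<close> and a set \<open>E\<close> of unordered pairs \<open>{x, y}\<close>.\<close>

definition infinite_simple_paths :: "'v set \<Rightarrow> 'v set set \<Rightarrow> 'v \<Rightarrow> (nat \<Rightarrow> 'v) set" where
  "infinite_simple_paths V E x =
     {\<gamma>. \<gamma> 0 = x \<and> range \<gamma> \<subseteq> V \<and> (\<forall>i. {\<gamma> i, \<gamma> (Suc i)} \<in> E) \<and> inj \<gamma>}"

text \<open>Meant for trees, where the number of infinite simple paths does not depend on the starting
  vertex; finiteness is required because \<open>card\<close> is 0 on infinite sets.\<close>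

definition has_topological_ends :: "'v set \<Rightarrow> 'v set set \<Rightarrow> nat \<Rightarrow> bool" where
  "has_topological_ends V E k \<longleftrightarrow>
     (\<forall>x\<in>V. finite (infinite_simple_paths V E x) \<and> card (infinite_simple_paths V E x) = k)"

text \<open>The vertex \<open>v\<^sub>i\<close> is the number \<open>i\<close>, and \<open>w n\<close> is the neighbour in \<open>T\<^sub>n\<close> chosen by the new
  vertex \<open>n + 1\<close>, for \<open>n \<ge> 1\<close>. The sequence of trees starts at \<open>T\<^sub>1\<close>; the values at index 0 are
  not used.\<close>

definition rrt_verts_upto :: "nat \<Rightarrow> nat set" where
  "rrt_verts_upto n = {0..n}"

fun rrt_edges_upto :: "(nat \<Rightarrow> nat) \<Rightarrow> nat \<Rightarrow> nat set set" where
  "rrt_edges_upto w 0 = {}"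
| "rrt_edges_upto w (Suc 0) = {{0, 1}}"
| "rrt_edges_upto w (Suc (Suc n)) =
     rrt_edges_upto w (Suc n) \<union> {{Suc (Suc n), w (Suc n)}}"

definition rrt_verts :: "nat set" where
  "rrt_verts = (\<Union>n\<in>{1..}. rrt_verts_upto n)"

definition rrt_edges :: "(nat \<Rightarrow> nat) \<Rightarrow> nat set set" where
  "rrt_edges w = (\<Union>n\<in>{1..}. rrt_edges_upto w n)"

end

theory Submission
  imports Defs
begin

text \<open>Let \<open>R\<close> consist of 0 and of the indices \<open>n\<close> with \<open>w n = n\<close>. Then the vertex \<open>n + 1\<close> is joined to
  \<open>n\<close> if \<open>n \<in> R\<close> and to \<open>n - 1\<close> otherwise. If \<open>R\<close> is finite, the tree eventually consists of two
  disjoint rays, one for each parity. If \<open>R\<close> is infinite, the edges can be oriented towards infinity: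
  they are the pairs \<open>{y, step y}\<close> for a map \<open>step\<close> whose orbits are injective and which admits no
  infinite injective backward orbit, so the only ray from \<open>x\<close> is the orbit of \<open>x\<close>. Hence the tree has
  one end iff \<open>R\<close> is infinite, which makes the event measurable, and by independence \<open>R\<close> is almost
  surely infinite.\<close>

section \<open>Rays in the graph of a map\<close>

text \<open>A simple path that once traverses an edge against \<open>N\<close> can never turn:
  \<open>N\<close> is single-valued, so a forward move next would revisit a vertex. From there on
  the path would be an infinite backward orbit.\<close>

lemma infinite_simple_paths_of_map:
  fixes N :: "'v \<Rightarrow> 'v"
  assumes inj: "inj (\<lambda>k. (N ^^ k) x)"
    and no_backward: "\<And>\<gamma>. inj \<gamma> \<Longrightarrow> \<exists>i. \<gamma> i \<noteq> N (\<gamma> (Suc i))"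
  shows "infinite_simple_paths UNIV {{y, N y} | y. True} x = {\<lambda>k. (N ^^ k) x}"
proof
  show "{\<lambda>k. (N ^^ k) x} \<subseteq> infinite_simple_paths UNIV {{y, N y} | y. True} x"
    using inj by (auto simp: infinite_simple_paths_def)
next
  show "infinite_simple_paths UNIV {{y, N y} | y. True} x \<subseteq> {\<lambda>k. (N ^^ k) x}"
  proof
    fix \<gamma> assume "\<gamma> \<in> infinite_simple_paths UNIV {{y, N y} | y. True} x"
    then have start: "\<gamma> 0 = x" and edge: "\<And>i. {\<gamma> i, \<gamma> (Suc i)} \<in> {{y, N y} | y. True}"
      and inj_\<gamma>: "inj \<gamma>"
      by (auto simp: infinite_simple_paths_def)
    have dir: "\<gamma> (Suc i) = N (\<gamma> i) \<or> \<gamma> i = N (\<gamma> (Suc i))" for i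
      using edge[of i] by (auto simp: doubleton_eq_iff)
    have turn: "\<gamma> (Suc i) = N (\<gamma> (Suc (Suc i)))" if "\<gamma> i = N (\<gamma> (Suc i))" for i
      using dir[of "Suc i"] that injD[OF inj_\<gamma>, of i "Suc (Suc i)"] by auto
    have forward: "\<gamma> (Suc i) = N (\<gamma> i)" for i
    proof (rule ccontr)
      assume "\<gamma> (Suc i) \<noteq> N (\<gamma> i)"
      then have "\<gamma> i = N (\<gamma> (Suc i))" using dir by blast
      then have "\<gamma> (i + j) = N (\<gamma> (Suc (i + j)))" for j
        by (induction j) (auto dest: turn)
      moreover have "inj (\<lambda>j. \<gamma> (i + j))"
        using injD[OF inj_\<gamma>] by (fastforce intro: injI)
      ultimately show False using no_backward[of "\<lambda>j. \<gamma> (i + j)"] by auto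
    qed
    have "\<gamma> k = (N ^^ k) x" for k
      by (induction k) (simp_all add: start forward)
    then show "\<gamma> \<in> {\<lambda>k. (N ^^ k) x}" by auto
  qed
qed

section \<open>The recursive tree\<close>

definition parent :: "nat set \<Rightarrow> nat \<Rightarrow> nat" where
  "parent R n = (if n - 1 \<in> R then n - 1 else n - 2)"

definition parent_edges :: "nat set \<Rightarrow> nat set set" where
  "parent_edges R = {{Suc n, parent R (Suc n)} | n. True}"

lemma rrt_verts_eq: "rrt_verts = UNIV"
proof -
  have "n \<in> rrt_verts_upto (Suc n)" for n by (simp add: rrt_verts_upto_def)
  then show ?thesis unfolding rrt_verts_def by fastforce
qed

lemma rrt_edges_upto_eq:
  assumes "n \<ge> 1"
  shows "rrt_edges_upto w n = insert {0, 1} ((\<lambda>k. {Suc k, w k}) ` {1..<n})"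
  using assms by (induction w n rule: rrt_edges_upto.induct) (auto simp: less_Suc_eq)

lemma rrt_edges_eq: "rrt_edges w = insert {0, 1} ((\<lambda>k. {Suc k, w k}) ` {1..})"
proof -
  have "rrt_edges w = (\<Union>n\<in>{1..}. insert {0, 1} ((\<lambda>k. {Suc k, w k}) ` {1..<n}))"
    by (simp add: rrt_edges_def rrt_edges_upto_eq)
  also have "\<dots> = insert {0, 1} ((\<lambda>k. {Suc k, w k}) ` (\<Union>n\<in>{1..}. {1..<n}))"
    by blast
  also have "(\<Union>n\<in>{1..}. {1..<n}) = {1::nat..}"
    by (auto intro: bexI[of _ "Suc _"])
  finally show ?thesis .
qed

text \<open>Since 0 counts as a link whatever \<open>w 0\<close> is, the starting edge
  \<open>{0, 1}\<close> fits the general pattern as the parent edge of 1.\<close>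

lemma rrt_edges_eq_parent_edges:
  assumes "\<And>n. n \<ge> 1 \<Longrightarrow> w n \<in> {n - 1, n}"
  shows "rrt_edges w = parent_edges (insert 0 {n. w n = n})"
proof -
  let ?R = "insert 0 {n. w n = n}"
  have "{Suc n, parent ?R (Suc n)} = (if n = 0 then {0, 1} else {Suc n, w n})" for n
    using assms[of n] by (auto simp: parent_def)
  then have "parent_edges ?R = range (\<lambda>n. if n = 0 then {0, 1} else {Suc n, w n})"
    by (auto simp: parent_edges_def)
  also have "\<dots> = insert {0, 1} ((\<lambda>k. {Suc k, w k}) ` {1..})"
    by (auto simp: image_iff Suc_le_eq)
  finally show ?thesis by (simp add: rrt_edges_eq)
qed

text \<open>Edges between vertices beyond the last link \<open>r\<close> have length 2. One ray from
  \<open>r\<close> proceeds by twos, the other first passes to \<open>r + 1\<close>.\<close>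

lemma not_one_end_if_finite:
  assumes "finite R" "R \<noteq> {}"
  shows "\<not> has_topological_ends UNIV (parent_edges R) 1"
proof
  define r where "r = Max R"
  have notin: "n \<notin> R" if "n > r" for n
    using that assms Max_ge[of R n] by (auto simp: r_def)
  have "r \<in> R" using assms by (simp add: r_def)
  \<comment> \<open>The second ray is r, r+1, r+3, and so on; its start is set separately because
    the general formula would give \<open>r - 1\<close>.\<close>
  define \<gamma> \<delta> where "\<gamma> = (\<lambda>k. r + 2 * k)" and "\<delta> = (\<lambda>k. if k = 0 then r else r + 2 * k - 1)"
  have two: "{n, n + 2} \<in> parent_edges R" if "n \<ge> r" for n
    using notin[of "Suc n"] that
    by (auto simp: parent_edges_def parent_def doubleton_eq_iff intro!: exI[of _ "Suc n"])
  have one: "{r, Suc r} \<in> parent_edges R"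
    using \<open>r \<in> R\<close> by (auto simp: parent_edges_def parent_def doubleton_eq_iff intro!: exI[of _ r])
  have "\<gamma> \<in> infinite_simple_paths UNIV (parent_edges R) r"
    using two by (auto simp: infinite_simple_paths_def \<gamma>_def inj_def)
  moreover have "\<delta> \<in> infinite_simple_paths UNIV (parent_edges R) r"
  proof -
    have "{\<delta> k, \<delta> (Suc k)} \<in> parent_edges R" for k
      using one two[of "r + 2 * k - 1"] by (cases k) (auto simp: \<delta>_def)
    moreover have "inj \<delta>"
      by (auto simp: inj_def \<delta>_def split: if_splits)
    ultimately show ?thesis by (auto simp: infinite_simple_paths_def \<delta>_def)
  qed
  moreover have "\<gamma> \<noteq> \<delta>"
    by (auto simp: \<gamma>_def \<delta>_def fun_eq_iff intro!: exI[of _ 1])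
  moreover assume "has_topological_ends UNIV (parent_edges R) 1"
  ultimately show False
    by (auto simp: has_topological_ends_def card_1_singleton_iff dest!: spec[of _ r])
qed

section \<open>Infinitely many links: orienting the edges towards infinity\<close>

locale infinite_links =
  fixes R :: "nat set"
  assumes zero_in: "0 \<in> R" and infinite: "infinite R"
begin

text \<open>This keeps the simplifier from splitting the parity of the distance to the next link
  into conditions on order and sum.\<close>

declare even_diff_nat [simp del]

definition next_link :: "nat \<Rightarrow> nat" where
  "next_link y = (LEAST r. r \<in> R \<and> y < r)"

definition prev_link :: "nat \<Rightarrow> nat" where
  "prev_link y = Max {r \<in> R. r \<le> y}"

text \<open>Strictly between consecutive elements of \<open>R\<close> every edge preserves parity, so the branch leading
  to infinity is the one with the parity of the next element of \<open>R\<close>.\<close>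

definition step :: "nat \<Rightarrow> nat" where
  "step y =
     (if even (next_link y - y) then y + 2 else if y \<in> R then y + 1 else parent R y)"

text \<open>This potential increases along \<open>step\<close>; a vertex on a dead branch gets its mirror image in the
  preceding element of \<open>R\<close>.\<close>

definition height :: "nat \<Rightarrow> int" where
  "height y =
     (if even (next_link y - y) \<or> y \<in> R then int y else 2 * int (prev_link y) - int y)"

lemma next_link: "next_link y \<in> R" "y < next_link y"
proof -
  have "\<exists>r. r \<in> R \<and> y < r"
    using infinite unfolding infinite_nat_iff_unbounded by blast
  from LeastI_ex[OF this] show "next_link y \<in> R" "y < next_link y"
    by (auto simp: next_link_def)
qed

lemma next_link_le: "r \<in> R \<Longrightarrow> y < r \<Longrightarrow> next_link y \<le> r"
  by (simp add: next_link_def Least_le)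

lemma next_link_Suc: "Suc y \<notin> R \<Longrightarrow> next_link (Suc y) = next_link y"
  by (metis next_link next_link_le Suc_lessD Suc_lessI le_antisym)

lemma prev_link: "prev_link y \<in> R" "prev_link y \<le> y"
proof -
  have "prev_link y \<in> {r \<in> R. r \<le> y}"
    unfolding prev_link_def by (rule Max_in) (use zero_in in \<open>auto intro: exI[of _ 0]\<close>)
  then show "prev_link y \<in> R" "prev_link y \<le> y" by auto
qed

lemma prev_link_self: "y \<in> R \<Longrightarrow> prev_link y = y"
  unfolding prev_link_def by (rule Max_eqI) auto

lemma prev_link_Suc:
  assumes "Suc y \<notin> R" shows "prev_link (Suc y) = prev_link y"
proof -
  have "{r \<in> R. r \<le> Suc y} = {r \<in> R. r \<le> y}" using assms le_Suc_eq by auto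
  then show ?thesis by (simp add: prev_link_def)
qed

lemma even_next_link_Suc:
  assumes "Suc y \<notin> R"
  shows "even (next_link (Suc y) - Suc y) \<longleftrightarrow> odd (next_link y - y)"
proof -
  have "next_link y - y = Suc (next_link (Suc y) - Suc y)"
    using next_link_Suc[OF assms] next_link(2)[of "Suc y"] by simp
  then show ?thesis by simp
qed

text \<open>A link at \<open>Suc y\<close> would make the distance 1. Hence the move from
  \<open>y\<close> to \<open>y + 2\<close> follows an edge.\<close>

lemma Suc_notin_if_even: "even (next_link y - y) \<Longrightarrow> Suc y \<notin> R"
  using next_link_le[of "Suc y" y] next_link(2)[of y] by (cases "next_link y = Suc y") auto

text \<open>Orbits never cross a link leftwards: only a non-link moves left, and it moves by 2 only
  if its left neighbour is not a link.\<close>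

lemma step_ge:
  assumes "r \<in> R" "r \<le> y" shows "r \<le> step y"
proof (cases "y \<in> R")
  case False
  with assms have "r < y" by (metis le_neq_implies_less)
  moreover have "y - 1 \<notin> R \<Longrightarrow> r \<noteq> y - 1" using assms by auto
  ultimately show ?thesis using assms by (auto simp: step_def parent_def)
qed (use assms in \<open>auto simp: step_def\<close>)

lemma height_le: "height y \<le> int y"
  using prev_link(2)[of y] by (auto simp: height_def)

lemma height_step: "height y < height (step y)"
proof -
  consider (good) "even (next_link y - y)" | (link) "odd (next_link y - y)" "y \<in> R"
    | (bad) "odd (next_link y - y)" "y \<notin> R" by blast
  then show ?thesis
  proof cases
    case good
    \<comment> \<open>Moving by 2 preserves the parity, unless a link is reached; either way the
      height is the vertex itself.\<close>
    have "Suc (Suc y) \<in> R \<or> even (next_link (Suc (Suc y)) - Suc (Suc y))"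
      using even_next_link_Suc[of y] even_next_link_Suc[of "Suc y"] Suc_notin_if_even good by blast
    then have "height (Suc (Suc y)) = int (y + 2)" by (auto simp: height_def)
    then show ?thesis using good height_le[of y] by (simp add: step_def)
  next
    case link
    then have "Suc y \<in> R \<or> even (next_link (Suc y) - Suc y)"
      using even_next_link_Suc[of y] by blast
    then show ?thesis using link by (auto simp: step_def height_def)
  next
    case bad
    then obtain z where y: "y = Suc z" using zero_in by (cases y) auto
    have z: "even (next_link z - z)" using bad even_next_link_Suc[of z] by (auto simp: y)
    have pz: "prev_link y = prev_link z" using bad prev_link_Suc[of z] by (simp add: y)
    have hy: "height y = 2 * int (prev_link y) - int y" using bad by (simp add: height_def)
    show ?thesis
    proof (cases "z \<in> R")
      case True
      then show ?thesis
        using bad hy pz prev_link_self[of z] by (simp add: step_def parent_def y height_def)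
    next
      case False
      then obtain u where u: "z = Suc u" using zero_in by (cases z) auto
      have s: "step y = u" using bad False by (simp add: step_def parent_def y u)
      \<comment> \<open>Thus \<open>u\<close> is on the same dead branch or is the preceding link,
        where the mirror formula also gives \<open>u\<close>; moving left by 2 raises the mirror
        image by 2.\<close>
      have "odd (next_link u - u)" using z even_next_link_Suc[of u] False by (auto simp: u)
      moreover have "prev_link z = prev_link u" using False prev_link_Suc[of u] by (simp add: u)
      ultimately show ?thesis
        using hy pz s prev_link_self[of u] by (simp add: height_def y u)
    qed
  qed
qed

lemma inj_step_orbit: "inj (\<lambda>k. (step ^^ k) x)"
proof -
  have "strict_mono (\<lambda>k. height ((step ^^ k) x))"
    by (simp add: strict_mono_Suc_iff height_step)
  then have "inj (height \<circ> (\<lambda>k. (step ^^ k) x))"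
    by (simp add: strict_mono_imp_inj_on comp_def)
  then show ?thesis by (rule inj_on_imageI2)
qed

text \<open>An injective sequence must reach some value at or beyond the first link \<open>r\<close>
  after its start. Applying \<open>step\<close> back down to the start cannot cross
  \<open>r\<close>.\<close>

lemma no_backward_orbit:
  assumes "inj \<gamma>" shows "\<exists>i. \<gamma> i \<noteq> step (\<gamma> (Suc i))"
proof (rule ccontr)
  assume "\<not> ?thesis"
  then have backward: "\<gamma> i = step (\<gamma> (Suc i))" for i by blast
  define r where "r = next_link (\<gamma> 0)"
  have "\<not> range \<gamma> \<subseteq> {..<r}"
    using finite_subset[of "range \<gamma>" "{..<r}"] range_inj_infinite[OF assms] by blast
  then have "\<exists>i. \<not> \<gamma> i < r" by blast
  then obtain i where "r \<le> \<gamma> i" by (auto simp only: not_less)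
  then have "r \<le> \<gamma> 0"
  proof (induction i)
    case (Suc i)
    then show ?case using step_ge[of r "\<gamma> (Suc i)"] next_link(1) backward[of i] by (auto simp: r_def)
  qed
  then show False using next_link(2)[of "\<gamma> 0"] by (simp add: r_def)
qed

lemma parent_edge_is_step: "\<exists>y. {Suc n, parent R (Suc n)} = {y, step y}"
proof (cases "step (Suc n) = parent R (Suc n)")
  case False
  have "step (parent R (Suc n)) = Suc n"
  proof (cases "n \<in> R")
    case True
    \<comment> \<open>Otherwise \<open>Suc n\<close> would lie on a dead branch and step to its
      parent.\<close>
    have "odd (next_link n - n)"
      using False True Suc_notin_if_even[of n] even_next_link_Suc[of n]
      by (auto simp: step_def)
    then show ?thesis using True by (simp add: parent_def step_def)
  next
    case False': False
    then obtain m where n: "n = Suc m" using zero_in by (cases n) auto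
    have p: "parent R (Suc n) = m" using False' by (simp add: parent_def n)
    have "even (next_link m - m)"
    proof (cases "Suc n \<in> R")
      case True
      then have "next_link n = Suc n"
        using next_link_le[of "Suc n" n] next_link(2)[of n] by simp
      then show ?thesis using even_next_link_Suc[of m] False' by (simp add: n)
    next
      case nR: False
      have "even (next_link (Suc n) - Suc n)"
        using False nR by (auto simp: step_def split: if_splits)
      then show ?thesis
        using even_next_link_Suc[of n] even_next_link_Suc[of m] nR False' by (simp add: n)
    qed
    then show ?thesis using p by (simp add: step_def n)
  qed
  then show ?thesis by (intro exI[of _ "parent R (Suc n)"]) (simp add: insert_commute)
qed auto

lemma step_is_parent_edge: "{y, step y} \<in> parent_edges R"
proof -
  consider "even (next_link y - y)" | "odd (next_link y - y)" "y \<in> R"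
    | "odd (next_link y - y)" "y \<notin> R" by blast
  then show ?thesis
  proof cases
    case 1
    then have "{y, step y} = {Suc (Suc y), parent R (Suc (Suc y))}"
      using Suc_notin_if_even[of y] by (auto simp: step_def parent_def)
    then show ?thesis by (auto simp: parent_edges_def)
  next
    case 2
    then have "{y, step y} = {Suc y, parent R (Suc y)}"
      by (auto simp: step_def parent_def)
    then show ?thesis by (auto simp: parent_edges_def)
  next
    case 3
    then obtain z where "y = Suc z" using zero_in by (cases y) auto
    then show ?thesis using 3 by (auto simp: step_def parent_edges_def)
  qed
qed

lemma parent_edges_eq: "parent_edges R = {{y, step y} | y. True}"
proof
  show "parent_edges R \<subseteq> {{y, step y} | y. True}"
    using parent_edge_is_step by (auto simp: parent_edges_def)
  show "{{y, step y} | y. True} \<subseteq> parent_edges R"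
    using step_is_parent_edge by auto
qed

lemma one_end: "has_topological_ends UNIV (parent_edges R) 1"
proof -
  have "infinite_simple_paths UNIV (parent_edges R) x = {\<lambda>k. (step ^^ k) x}" for x
    unfolding parent_edges_eq
    by (rule infinite_simple_paths_of_map[OF inj_step_orbit]) (rule no_backward_orbit)
  then show ?thesis by (simp add: has_topological_ends_def)
qed

end

lemma rrt_one_end_iff:
  assumes "\<And>n. n \<ge> 1 \<Longrightarrow> w n \<in> {n - 1, n}"
  shows "has_topological_ends rrt_verts (rrt_edges w) 1 \<longleftrightarrow> infinite {n. w n = n}"
proof -
  let ?R = "insert 0 {n. w n = n}"
  have "has_topological_ends UNIV (parent_edges ?R) 1" if "infinite {n. w n = n}"
    by (rule infinite_links.one_end) (use that in \<open>simp add: infinite_links_def\<close>)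
  moreover have "\<not> has_topological_ends UNIV (parent_edges ?R) 1" if "finite {n. w n = n}"
    by (rule not_one_end_if_finite) (use that in auto)
  ultimately show ?thesis
    by (auto simp: rrt_verts_eq rrt_edges_eq_parent_edges[OF assms])
qed

section \<open>Infinitely many links to the last vertex\<close>

text \<open>Any \<open>k\<close> of the events occur together with probability at most
  \<open>q ^ k\<close>, which tends to 0.\<close>

lemma (in prob_space) AE_ex_not_of_indep_events:
  assumes indep: "indep_events (\<lambda>i. {x \<in> space M. P i x}) I"
    and "infinite I" and "q < 1"
    and bound: "\<And>i. i \<in> I \<Longrightarrow> prob {x \<in> space M. P i x} \<le> q"
  shows "AE x in M. \<exists>i\<in>I. \<not> P i x"
proof -
  let ?F = "\<lambda>i. {x \<in> space M. P i x}"
  have ev: "?F i \<in> events" if "i \<in> I" for i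
    using indep that by (auto simp: indep_events_def)
  obtain i0 where "i0 \<in> I" using \<open>infinite I\<close> by fastforce
  then have "0 \<le> q" using bound[of i0] measure_nonneg[of M "?F i0"] by linarith
  have "\<exists>J\<subseteq>I. finite J \<and> J \<noteq> {} \<and> prob (\<Inter>i\<in>J. ?F i) \<le> q ^ Suc k" for k
  proof -
    obtain J where J: "J \<subseteq> I" "finite J" "card J = Suc k"
      using infinite_arbitrarily_large[OF \<open>infinite I\<close>] by blast
    then have "J \<noteq> {}" by auto
    then have "prob (\<Inter>i\<in>J. ?F i) = (\<Prod>i\<in>J. prob (?F i))"
      using indep J by (simp add: indep_events_def)
    also have "\<dots> \<le> (\<Prod>i\<in>J. q)"
      using bound J by (intro prod_mono) auto
    finally show ?thesis using J \<open>J \<noteq> {}\<close> by auto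
  qed
  then obtain J where J: "\<And>k. J k \<subseteq> I" "\<And>k. finite (J k)" "\<And>k. J k \<noteq> {}"
    "\<And>k. prob (\<Inter>i\<in>J k. ?F i) \<le> q ^ Suc k" by metis
  \<comment> \<open>Intersecting over countably many finite sets keeps this measurable even if
    \<open>I\<close> is uncountable.\<close>
  let ?N = "\<Inter>k. \<Inter>i\<in>J k. ?F i"
  have evJ: "(\<Inter>i\<in>J k. ?F i) \<in> events" for k
    using J(1-3)[of k] ev by (intro sets.finite_INT) auto
  then have N: "?N \<in> events" by (intro sets.countable_INT) auto
  have "prob ?N \<le> q ^ Suc k" for k
    using finite_measure_mono[OF _ evJ, of ?N k] J(4)[of k] by fastforce
  moreover have "(\<lambda>k. q ^ Suc k) \<longlonglongrightarrow> 0"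
    using \<open>0 \<le> q\<close> \<open>q < 1\<close> by (intro LIMSEQ_Suc LIMSEQ_realpow_zero)
  ultimately have "prob ?N \<le> 0"
    by (intro LIMSEQ_le_const[of "\<lambda>k. q ^ Suc k"]) auto
  then have "?N \<in> null_sets M"
    using N measure_nonneg[of M ?N] by (intro null_setsI) (auto simp: emeasure_eq_measure)
  then show ?thesis
    by (rule AE_I') (use J(1) in blast)
qed

theorem theorem1p1:
  fixes M :: "'a measure" and w :: "nat \<Rightarrow> 'a \<Rightarrow> nat" and p q :: real
  assumes "prob_space M"
    and "0 < p" and "p \<le> 1" and "q = 1 - p"
    and "prob_space.indep_vars M (\<lambda>n. count_space {n - 1, n}) w {1..}"
    and "\<And>n. n \<ge> 1 \<Longrightarrow> measure M {\<omega> \<in> space M. w n \<omega> = n} = p"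
    and "\<And>n. n \<ge> 1 \<Longrightarrow> measure M {\<omega> \<in> space M. w n \<omega> = n - 1} = q"
  shows "measure M {\<omega> \<in> space M. has_topological_ends rrt_verts (rrt_edges (\<lambda>n. w n \<omega>)) 1} = 1"
proof -
  interpret prob_space M by fact
  have meas: "w n \<in> M \<rightarrow>\<^sub>M count_space {n - 1, n}" if "n \<ge> 1" for n
    using assms(5) that by (auto simp: indep_vars_def2)
  \<comment> \<open>The codomain of the measurable map forces this at every point, not just almost
    surely.\<close>
  have vals: "w n \<omega> \<in> {n - 1, n}" if "n \<ge> 1" "\<omega> \<in> space M" for n \<omega>
    using measurable_space[OF meas[OF that(1)] that(2)] by simp
  have link_event: "{\<omega> \<in> space M. w n \<omega> = n} \<in> events" if "n \<ge> 1" for n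
  proof -
    have "w n -` {n} \<inter> space M \<in> events" by (rule measurable_sets[OF meas[OF that]]) simp
    moreover have "w n -` {n} \<inter> space M = {\<omega> \<in> space M. w n \<omega> = n}" by auto
    ultimately show ?thesis by simp
  qed
  \<comment> \<open>Tails start at \<open>Suc m\<close> to avoid index 0, about which nothing is
    assumed.\<close>
  have inf_iff: "infinite {n. w n \<omega> = n} \<longleftrightarrow> (\<forall>m. \<exists>n\<in>{Suc m..}. w n \<omega> = n)" for \<omega>
    by (auto simp: infinite_nat_iff_unbounded Suc_le_eq Bex_def)
  have ends_iff: "has_topological_ends rrt_verts (rrt_edges (\<lambda>n. w n \<omega>)) 1 \<longleftrightarrow>
      (\<forall>m. \<exists>n\<in>{Suc m..}. w n \<omega> = n)" if "\<omega> \<in> space M" for \<omega>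
    using rrt_one_end_iff[of "\<lambda>n. w n \<omega>"] vals that inf_iff by blast
  have "{\<omega> \<in> space M. has_topological_ends rrt_verts (rrt_edges (\<lambda>n. w n \<omega>)) 1} =
      {\<omega> \<in> space M. \<forall>m. \<exists>n\<in>{Suc m..}. w n \<omega> = n}"
    using ends_iff by blast
  \<comment> \<open>Needed because \<open>measure\<close> is 0 by convention on non-measurable
    sets.\<close>
  moreover have "{\<omega> \<in> space M. \<forall>m. \<exists>n\<in>{Suc m..}. w n \<omega> = n} \<in> events"
    using link_event by (intro sets.sets_Collect_countable_All sets.sets_Collect_countable_Ex') auto
  moreover have "AE \<omega> in M. \<forall>m. \<exists>n\<in>{Suc m..}. w n \<omega> = n"
    unfolding AE_all_countable
  proof
    fix m
    have "indep_vars (\<lambda>n. count_space {n - 1, n}) w {Suc m..}"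
      by (rule indep_vars_subset[OF assms(5)]) auto
    then have "indep_events (\<lambda>n. {\<omega> \<in> space M. w n \<omega> = n - 1}) {Suc m..}"
      by (rule indep_eventsI_indep_vars) auto
    \<comment> \<open>Each tail is an infinite independent family with common probability
      \<open>q\<close>, and \<open>q < 1\<close> because \<open>0 < p\<close>.\<close>
    then have "AE \<omega> in M. \<exists>n\<in>{Suc m..}. \<not> w n \<omega> = n - 1"
      using assms by (intro AE_ex_not_of_indep_events[where q = q]) (auto simp: infinite_Ici)
    then show "AE \<omega> in M. \<exists>n\<in>{Suc m..}. w n \<omega> = n"
      using AE_space
    proof eventually_elim
      case (elim \<omega>)
      then obtain n where "n \<ge> Suc m" "w n \<omega> \<noteq> n - 1" by auto
      then show ?case using vals[of n \<omega>] elim(2) by auto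
    qed
  qed
  ultimately show ?thesis by (simp add: prob_Collect_eq_1)
qed

end
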